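(* For every integer $n\ge 0$ and every $r\in\{6,20,27,34,41,48\}$, $c_8(49n+r)\equiv 0\pmod 2$.
   Context: A partition of $n\ge 0$ is a finite multiset of positive integers summing to $n$; the empty partition is the partition of $0$. For $n\ge 0$, $c_8(n)$ denotes the number of partitions $\lambda$ of $n$ such that either (a) all parts of $\lambda$ are even and distinct, or (b) there is an integer $j\ge 1$ such that the set of odd parts of $\lambda$ is exactly $\{1,3,\dots,2j-1\}$, each odd part at most $j$ appears once or twice, each odd part greater than $j$ appears exactly once, the even parts of $\lambda$ are distinct, and no even part lies in the interval $(j,2j]$ (i.e. every even part greater than $j$ is at least $2j+2$). *)

theory Defs
  imports Main "HOL-Library.Multiset"
begin

definition partitions :: "nat \<Rightarrow> nat multiset set" where
  "partitions n = {p. (\<forall>x\<in>#p. 0 < x) \<and> sum_mset p = n}"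

definition cond_a :: "nat multiset \<Rightarrow> bool" where
  "cond_a p \<longleftrightarrow> (\<forall>x\<in>#p. even x) \<and> (\<forall>x. count p x \<le> 1)"

definition cond_b :: "nat \<Rightarrow> nat multiset \<Rightarrow> bool" where
  "cond_b j p \<longleftrightarrow>
     1 \<le> j \<and>
     {x \<in> set_mset p. odd x} = {2*i - 1 | i. 1 \<le> i \<and> i \<le> j} \<and>
     (\<forall>x. odd x \<and> x \<le> j \<longrightarrow> count p x = 1 \<or> count p x = 2) \<and>
     (\<forall>x. odd x \<and> j < x \<and> x \<in># p \<longrightarrow> count p x = 1) \<and>
     (\<forall>x. even x \<longrightarrow> count p x \<le> 1) \<and>
     (\<forall>x\<in>#p. even x \<longrightarrow> \<not> (j < x \<and> x \<le> 2*j))"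

definition c8 :: "nat \<Rightarrow> nat" where
  "c8 n = card {p \<in> partitions n. cond_a p \<or> (\<exists>j. cond_b j p)}"

end

theory Submission
  imports Defs "HOL-Library.Z2" "HOL-Computational_Algebra.Formal_Power_Series"
begin

text \<open>
  The partitions with odd parts \<open>1, 3, \<dots>, 2j - 1\<close> have the generating function
  \<open>q ^ j\<^sup>2 (-q; q)\<^sub>j (-q ^ (2j + 2); q\<^sup>2)\<^sub>\<infinity>\<close>, which is congruent to
  \<open>(q; q)\<^sub>\<infinity>\<^sup>2 q ^ j\<^sup>2 / (q; q)\<^sub>j\<close> modulo 2. Summing over \<open>j\<close> produces the Rogers-Ramanujan series,
  so modulo 2 the generating function of \<open>c8\<close> is \<open>\<Sum> q ^ (t (3t + 1) / 2) * \<Sum> q ^ (u (5u + 1) / 2)\<close>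
  over all integers \<open>t\<close>, \<open>u\<close>. Finite forms of the Rogers-Ramanujan identity and of the pentagonal number
  theorem both come from iterating Bailey's lemma on the unit Bailey pair; they agree with the
  infinite identities up to \<open>q ^ N\<close>.

  A nonzero coefficient at \<open>n\<close> gives \<open>120 n + 8 = 5 (6t + 1)\<^sup>2 + 3 (10u + 1)\<^sup>2\<close>. As \<open>-15\<close> is not a square
  modulo 7, the right-hand side is divisible by 49 as soon as it is divisible by 7, which fails for
  the given residues of \<open>n\<close> modulo 49.
\<close>

unbundle fps_syntax

subsection \<open>Bailey's lemma and the finite identities\<close>

text \<open>The q-Pochhammer symbol \<open>(q; q)_n\<close> with q = \<open>fps_X\<close>; below, q
  always stands for \<open>fps_X\<close>.\<close>

definition qfact :: "nat \<Rightarrow> 'a::field fps" where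
  "qfact n = (\<Prod>i=1..n. 1 - fps_X ^ i)"

definition iqfact :: "nat \<Rightarrow> 'a::field fps" where
  "iqfact n = inverse (qfact n)"

lemma qfact_0 [simp]: "qfact 0 = 1"
  by (simp add: qfact_def)

lemma qfact_Suc: "qfact (Suc n) = qfact n * (1 - fps_X ^ Suc n)"
  by (simp add: qfact_def)

lemma qfact_nth_0 [simp]: "qfact n $ 0 = 1"
  by (induction n) (simp_all add: qfact_Suc)

lemma iqfact_0 [simp]: "iqfact 0 = 1"
  by (simp add: iqfact_def)

lemma iqfact_mult_qfact [simp]: "iqfact n * qfact n = 1"
  by (simp add: iqfact_def inverse_mult_eq_1)

lemma iqfact_Suc: "iqfact (Suc n) * (1 - fps_X ^ Suc n) = iqfact n"
proof -
  have "iqfact (Suc n) * (1 - fps_X ^ Suc n) * (qfact n * iqfact n) = iqfact (Suc n) * qfact (Suc n) * (iqfact n :: 'a fps)"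
    by (simp only: qfact_Suc ac_simps)
  then show ?thesis
    by (simp add: mult.commute[of "qfact n"])
qed

text \<open>A form of q-Vandermonde, by induction on \<open>M\<close> for all \<open>a\<close> at
  once. Multiplying by 1 - q^(M+1) and splitting this factor as (1 - q^(M+1-t)) + q^(M+1-t) (1 -
  q^t) lowers \<open>iqfact (Suc M - t)\<close> in one sum and \<open>iqfact t\<close> in the other.
  The first is the sum for \<open>M\<close> and \<open>a\<close>; the second, after the shift t = u
  + 1, is q^(M+1+a) times the sum for \<open>M\<close> and \<open>a + 1\<close>.\<close>

lemma q_vandermonde_iqfact:
  "(\<Sum>t\<le>M. fps_X ^ (t * t + a * t) * iqfact (M - t) * iqfact t * iqfact (t + a))
     = (iqfact M * iqfact (M + a) :: 'a::field fps)"
proof (induction M arbitrary: a)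
  case 0
  show ?case by simp
next
  case (Suc M)
  let ?F = "\<lambda>M a t. fps_X ^ (t * t + a * t) * iqfact (M - t) * iqfact t * iqfact (t + a) :: 'a fps"
  let ?q = "fps_X :: 'a fps"
  have step1: "?F (Suc M) a t * (1 - ?q ^ (Suc M - t)) = ?F M a t" if "t \<le> M" for t
  proof -
    have "Suc M - t = Suc (M - t)" using that by simp
    then show ?thesis
      using iqfact_Suc[of "M - t", where 'a='a] by (simp add: mult.assoc mult.left_commute mult.commute del: power_Suc)
  qed
  have step2: "?F (Suc M) a (Suc u) * (?q ^ (Suc M - Suc u) * (1 - ?q ^ Suc u)) = ?q ^ (Suc M + a) * ?F M (Suc a) u"
    if "u \<le> M" for u
  proof -
    have e: "Suc u * Suc u + a * Suc u + (M - u) = Suc M + a + (u * u + Suc a * u)"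
      using that by (simp add: algebra_simps)
    have "?F (Suc M) a (Suc u) * (?q ^ (Suc M - Suc u) * (1 - ?q ^ Suc u))
      = ?q ^ (Suc u * Suc u + a * Suc u + (M - u)) * iqfact (M - u) * (iqfact (Suc u) * (1 - ?q ^ Suc u)) * iqfact (Suc u + a)"
      by (simp only: power_add ac_simps diff_Suc_Suc)
    also have "\<dots> = ?q ^ (Suc M + a) * ?F M (Suc a) u"
      unfolding e iqfact_Suc by (simp add: power_add ac_simps)
    finally show ?thesis .
  qed
  have split: "1 - ?q ^ Suc M = (1 - ?q ^ (Suc M - t)) + ?q ^ (Suc M - t) * (1 - ?q ^ t)" if "t \<le> Suc M" for t
    using that by (simp add: algebra_simps flip: power_add power_Suc)
  have "(\<Sum>t\<le>Suc M. ?F (Suc M) a t) * (1 - ?q ^ Suc M)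
     = (\<Sum>t\<le>Suc M. ?F (Suc M) a t * (1 - ?q ^ (Suc M - t)))
       + (\<Sum>t\<le>Suc M. ?F (Suc M) a t * (?q ^ (Suc M - t) * (1 - ?q ^ t)))"
    unfolding sum_distrib_right sum.distrib[symmetric] distrib_left[symmetric]
    by (intro sum.cong refl arg_cong2[where f="(*)"] split) simp
  also have "(\<Sum>t\<le>Suc M. ?F (Suc M) a t * (1 - ?q ^ (Suc M - t))) = (\<Sum>t\<le>M. ?F M a t)"
    by (rule trans[OF _ sum.cong[OF refl step1]]) simp_all
  also have "(\<Sum>t\<le>Suc M. ?F (Suc M) a t * (?q ^ (Suc M - t) * (1 - ?q ^ t)))
      = (\<Sum>u\<le>M. ?q ^ (Suc M + a) * ?F M (Suc a) u)"
    by (rule trans[OF _ sum.cong[OF refl step2]]) (simp_all add: sum.atMost_Suc_shift del: sum.atMost_Suc power_Suc)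
  also have "(\<Sum>t\<le>M. ?F M a t) + (\<Sum>u\<le>M. ?q ^ (Suc M + a) * ?F M (Suc a) u)
      = iqfact M * iqfact (M + a) + ?q ^ (Suc M + a) * (iqfact M * iqfact (Suc (M + a)))"
    unfolding sum_distrib_left[symmetric] Suc.IH by simp
  also have "iqfact (M + a) = iqfact (Suc (M + a)) * (1 - ?q ^ Suc (M + a))"
    by (rule iqfact_Suc[symmetric])
  also have "iqfact M * (iqfact (Suc (M + a)) * (1 - ?q ^ Suc (M + a))) + ?q ^ (Suc M + a) * (iqfact M * iqfact (Suc (M + a)))
      = iqfact (Suc (M + a)) * iqfact M"
    by (simp add: algebra_simps)
  also have "\<dots> = iqfact (Suc M) * iqfact (Suc M + a) * (1 - ?q ^ Suc M)"
    unfolding iqfact_Suc[of M, symmetric] by (simp add: ac_simps)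
  finally have "(\<Sum>t\<le>Suc M. ?F (Suc M) a t) * (1 - ?q ^ Suc M) = iqfact (Suc M) * iqfact (Suc M + a) * (1 - ?q ^ Suc M)" .
  moreover have "1 - ?q ^ Suc M \<noteq> 0"
  proof
    assume "1 - ?q ^ Suc M = 0"
    then have "(1 - ?q ^ Suc M) $ 0 = 0" by simp
    then show False by simp
  qed
  ultimately show ?case by simp
qed

text \<open>The case a = 1 of Bailey's lemma with both free parameters sent to infinity. After
  interchanging the sums and putting s = m + t, the inner sum is \<open>q_vandermonde_iqfact\<close>
  with \<open>N - m\<close> for \<open>M\<close> and \<open>2 * m\<close> for
  \<open>a\<close>.\<close>

lemma bailey_lemma:
  fixes \<alpha> :: "nat \<Rightarrow> 'a::field fps"
  shows "(\<Sum>s\<le>N. fps_X ^ (s * s) * iqfact (N - s) * (\<Sum>m\<le>s. \<alpha> m * iqfact (s - m) * iqfact (s + m)))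
       = (\<Sum>m\<le>N. fps_X ^ (m * m) * \<alpha> m * iqfact (N - m) * iqfact (N + m))"
proof -
  let ?q = "fps_X :: 'a fps"
  have "(\<Sum>s\<le>N. ?q ^ (s * s) * iqfact (N - s) * (\<Sum>m\<le>s. \<alpha> m * iqfact (s - m) * iqfact (s + m)))
     = (\<Sum>s\<le>N. \<Sum>m\<le>s. ?q ^ (s * s) * iqfact (N - s) * (\<alpha> m * iqfact (s - m) * iqfact (s + m)))"
    by (simp add: sum_distrib_left)
  also have "\<dots> = (\<Sum>m\<le>N. \<Sum>s\<in>{m..N}. ?q ^ (s * s) * iqfact (N - s) * (\<alpha> m * iqfact (s - m) * iqfact (s + m)))"
    by (subst (1 2) sum.Sigma)
       (auto intro!: sum.reindex_bij_witness[of _ "\<lambda>(m,s). (s,m)" "\<lambda>(s,m). (m,s)"])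
  also have "\<dots> = (\<Sum>m\<le>N. ?q ^ (m * m) * \<alpha> m * iqfact (N - m) * iqfact (N + m))"
  proof (rule sum.cong[OF refl])
    fix m assume "m \<in> {..N}"
    then have m: "m \<le> N" by simp
    have "(\<Sum>s\<in>{m..N}. ?q ^ (s * s) * iqfact (N - s) * (\<alpha> m * iqfact (s - m) * iqfact (s + m)))
       = (\<Sum>t\<le>N - m. ?q ^ (m * m) * \<alpha> m *
            (?q ^ (t * t + (2 * m) * t) * iqfact (N - m - t) * iqfact t * iqfact (t + 2 * m)))"
    proof (rule sum.reindex_bij_witness[of _ "\<lambda>t. t + m" "\<lambda>s. s - m"], goal_cases)
      case (5 s)
      then obtain t where s: "s = m + t" by (auto dest: le_Suc_ex)
      have "(m + t) * (m + t) = m * m + (t * t + (2 * m) * t)" by (simp add: algebra_simps)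
      moreover have "m + t + m = t + 2 * m" by simp
      ultimately show ?case unfolding s by (simp only: power_add diff_diff_left diff_add_inverse ac_simps)
    qed (use m in auto)
    also have "\<dots> = ?q ^ (m * m) * \<alpha> m * iqfact (N - m) * iqfact (N + m)"
      unfolding sum_distrib_left[symmetric] q_vandermonde_iqfact using m
      by (simp add: mult_2 mult.assoc)
    finally show "(\<Sum>s\<in>{m..N}. ?q ^ (s * s) * iqfact (N - s) * (\<alpha> m * iqfact (s - m) * iqfact (s + m)))
      = ?q ^ (m * m) * \<alpha> m * iqfact (N - m) * iqfact (N + m)" .
  qed
  finally show ?thesis .
qed

section \<open>The unit Bailey pair and its iterates\<close>

text \<open>The terms \<open>(-1) ^ m * q ^ (m * (m + 1) / 2)\<close> of index \<open>m\<close> and \<open>- m\<close>, grouped together.\<close>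

definition unit_bailey :: "nat \<Rightarrow> 'a::field fps" where
  "unit_bailey m = (if m = 0 then 1 else (-1) ^ m * fps_X ^ (m choose 2) * (1 + fps_X ^ m))"

text \<open>The sum telescopes: its partial sums have a closed form, found by induction on
  \<open>M\<close>. The factor 1 - q^(2(s+1)) on the left avoids a division. The range stops at
  \<open>M \<le> s\<close>, one term short of the full sum.\<close>

lemma unit_bailey_partial_sum:
  assumes "M \<le> s"
  shows "(1 - fps_X ^ (2 * Suc s)) * (\<Sum>m\<le>M. unit_bailey m * iqfact (Suc s - m) * iqfact (Suc s + m))
    = (-1) ^ M * (1 + fps_X ^ Suc s) * fps_X ^ (Suc M choose 2) * iqfact (s - M) * (iqfact (Suc s + M) :: 'a::field fps)"
  using assms
proof (induction M)
  case 0
  let ?q = "fps_X :: 'a fps"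
  have "(1 - ?q ^ (2 * Suc s)) = (1 + ?q ^ Suc s) * (1 - ?q ^ Suc s)"
    by (simp only: mult_2 power_add) (simp add: algebra_simps)
  then have "(1 - ?q ^ (2 * Suc s)) * (iqfact (Suc s) * iqfact (Suc s))
    = (1 + ?q ^ Suc s) * (iqfact (Suc s) * (1 - ?q ^ Suc s)) * iqfact (Suc s)"
    by (simp only: ac_simps)
  then show ?case
    by (simp add: unit_bailey_def iqfact_Suc numeral_2_eq_2 mult.assoc del: power_Suc)
next
  case (Suc M)
  let ?q = "fps_X :: 'a fps"
  define d where "d = s - Suc M"
  have s: "s = Suc M + d" using Suc.prems by (simp add: d_def)
  have eq: "s - M = Suc d" "Suc s - Suc M = Suc d" "s - Suc M = d"
    using s by simp_all
  define A where "A = iqfact (Suc d) * (iqfact (Suc (Suc s + M)) :: 'a fps)"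
  define T where "T = ?q ^ (Suc M choose 2)"
  have ch: "Suc (Suc M) choose 2 = (Suc M choose 2) + Suc M"
    by (simp add: numeral_2_eq_2)
  have "(1 - ?q ^ (2 * Suc s)) * (\<Sum>m\<le>Suc M. unit_bailey m * iqfact (Suc s - m) * iqfact (Suc s + m))
    = (-1) ^ M * (1 + ?q ^ Suc s) * T * iqfact (Suc d) * (iqfact (Suc (Suc s + M)) * (1 - ?q ^ Suc (Suc s + M)))
      + (1 - ?q ^ (2 * Suc s)) * ((-1) ^ Suc M * T * (1 + ?q ^ Suc M) * A)"
    using Suc unfolding iqfact_Suc
    by (simp add: distrib_left eq T_def A_def unit_bailey_def mult.assoc del: power_Suc)
  also have "\<dots> = (-1) ^ M * T * A * ((1 + ?q ^ Suc s) * (1 - ?q ^ Suc (Suc s + M)) - (1 - ?q ^ (2 * Suc s)) * (1 + ?q ^ Suc M))"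
    by (simp add: A_def algebra_simps)
  \<comment> \<open>With x = q^(s+1), y = q^(M+1), z = q^(d+1) and x = y z, the left side is (1 + x)
    (x - y) = - (1 + x) y (1 - z).\<close>
  also have "(1 + ?q ^ Suc s) * (1 - ?q ^ Suc (Suc s + M)) - (1 - ?q ^ (2 * Suc s)) * (1 + ?q ^ Suc M)
     = - ((1 + ?q ^ Suc s) * ?q ^ Suc M * (1 - ?q ^ Suc d))"
  proof -
    have "?q ^ Suc (Suc s + M) = ?q ^ Suc s * ?q ^ Suc M" "?q ^ (2 * Suc s) = ?q ^ Suc s * ?q ^ Suc s"
      "?q ^ Suc s = ?q ^ Suc M * ?q ^ Suc d"
      by (simp_all add: s mult_2 flip: power_add power_Suc)
    then show ?thesis by (simp only:) (simp add: algebra_simps del: power_Suc)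
  qed
  also have "(-1) ^ M * T * A * - ((1 + ?q ^ Suc s) * ?q ^ Suc M * (1 - ?q ^ Suc d))
     = (-1) ^ Suc M * (1 + ?q ^ Suc s) * (T * ?q ^ Suc M) * (iqfact (Suc d) * (1 - ?q ^ Suc d)) * iqfact (Suc (Suc s + M))"
    by (simp only: A_def power_Suc mult_minus_left mult_minus_right mult_1_left ac_simps)
  also have "\<dots> = (-1) ^ Suc M * (1 + ?q ^ Suc s) * ?q ^ (Suc (Suc M) choose 2) * iqfact (s - Suc M) * iqfact (Suc s + Suc M)"
    unfolding iqfact_Suc ch power_add T_def eq by (simp add: ac_simps)
  finally show ?case .
qed

text \<open>For positive s the closed form for the first s terms cancels against the last term m =
  s, once both carry the factor 1 - q^(2s).\<close>

lemma unit_bailey_pair: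
  "(\<Sum>m\<le>s. unit_bailey m * iqfact (s - m) * iqfact (s + m)) = (if s = 0 then 1 else 0 :: 'a::field fps)"
proof (cases s)
  case 0
  then show ?thesis by (simp add: unit_bailey_def)
next
  case (Suc t)
  let ?q = "fps_X :: 'a fps"
  have e: "Suc (Suc t + t) = 2 * Suc t" by simp
  have "(1 - ?q ^ (2 * Suc t)) * (\<Sum>m\<le>Suc t. unit_bailey m * iqfact (Suc t - m) * iqfact (Suc t + m))
     = (-1) ^ t * (1 + ?q ^ Suc t) * ?q ^ (Suc t choose 2) * (iqfact (Suc (Suc t + t)) * (1 - ?q ^ Suc (Suc t + t)))
       + (1 - ?q ^ (2 * Suc t)) * ((-1) ^ Suc t * ?q ^ (Suc t choose 2) * (1 + ?q ^ Suc t) * iqfact (Suc (Suc t + t)))"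
    unfolding iqfact_Suc using unit_bailey_partial_sum[of t t, where 'a='a]
    by (simp add: distrib_left unit_bailey_def mult.assoc del: power_Suc)
  also have "\<dots> = 0"
    unfolding e by (simp add: algebra_simps)
  finally have "(1 - ?q ^ (2 * Suc t)) * (\<Sum>m\<le>Suc t. unit_bailey m * iqfact (Suc t - m) * iqfact (Suc t + m)) = 0" .
  moreover have "1 - ?q ^ (2 * Suc t) \<noteq> 0"
  proof
    assume "1 - ?q ^ (2 * Suc t) = 0"
    then have "(1 - ?q ^ (2 * Suc t)) $ 0 = 0" by simp
    then show False by simp
  qed
  ultimately show ?thesis using Suc by simp
qed

text \<open>Bailey's lemma for the unit pair: only s = 0 survives on its left-hand side.\<close>

lemma finite_pentagonal:
  "(\<Sum>m\<le>N. fps_X ^ (m * m) * unit_bailey m * iqfact (N - m) * iqfact (N + m)) = (iqfact N :: 'a::field fps)"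
  unfolding bailey_lemma[symmetric] unit_bailey_pair
  by (simp add: sum.delta if_distrib[of "\<lambda>x. _ * x"] cong: if_cong)

text \<open>A second application of Bailey's lemma, with q^(m^2) \<open>unit_bailey m\<close> as
  \<alpha>; its inner sums are \<open>iqfact s\<close> by \<open>finite_pentagonal\<close>.\<close>

lemma finite_rogers_ramanujan:
  "(\<Sum>m\<le>N. fps_X ^ (2 * m * m) * unit_bailey m * iqfact (N - m) * iqfact (N + m))
     = (\<Sum>s\<le>N. fps_X ^ (s * s) * iqfact (N - s) * iqfact s :: 'a::field fps)"
proof -
  have "(\<Sum>s\<le>N. fps_X ^ (s * s) * iqfact (N - s) * iqfact s :: 'a fps)
    = (\<Sum>m\<le>N. fps_X ^ (m * m) * (fps_X ^ (m * m) * unit_bailey m) * iqfact (N - m) * iqfact (N + m))"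
    by (subst bailey_lemma[symmetric]) (simp only: finite_pentagonal)
  also have "\<dots> = (\<Sum>m\<le>N. fps_X ^ (2 * m * m) * unit_bailey m * iqfact (N - m) * iqfact (N + m))"
    by (simp add: mult_2 add_mult_distrib power_add mult.assoc)
  finally show ?thesis ..
qed

subsection \<open>Truncation to theta series\<close>

lemma qfact_diff_dvd: "M \<le> N \<Longrightarrow> fps_X ^ Suc M dvd qfact N - (qfact M :: 'a::field fps)"
proof (induction N rule: dec_induct)
  case (step N)
  have "qfact (Suc N) - qfact M = (qfact N - qfact M) - fps_X ^ Suc N * (qfact N :: 'a fps)"
    by (simp add: qfact_Suc algebra_simps)
  moreover have "fps_X ^ Suc M dvd fps_X ^ Suc N * (qfact N :: 'a fps)"
    using step by (intro dvd_mult2 le_imp_power_dvd) simp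
  ultimately show ?case using step.IH by (metis dvd_diff)
qed simp

text \<open>Divisibility of a difference by q^(K+1) stands for agreement of all coefficients up to
  index \<open>K\<close>. Both q-factorials agree with \<open>qfact K\<close> to this order.\<close>

lemma qfact_iqfact_dvd:
  assumes "K \<le> M" "K \<le> N"
  shows "fps_X ^ Suc K dvd qfact N * iqfact M - (1 :: 'a::field fps)"
proof -
  have "fps_X ^ Suc K dvd (qfact N - qfact K) - (qfact M - qfact K :: 'a fps)"
    using assms by (intro dvd_diff qfact_diff_dvd)
  then have "fps_X ^ Suc K dvd (qfact N - qfact M :: 'a fps)" by simp
  then have "fps_X ^ Suc K dvd (qfact N - qfact M) * (iqfact M :: 'a fps)" by (rule dvd_mult2)
  then show ?thesis by (simp add: left_diff_distrib mult.commute[of "qfact M"] del: power_Suc)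
qed

lemma fps_nth_eq_if_X_power_dvd_diff:
  fixes a b :: "'a::comm_ring_1 fps"
  assumes "fps_X ^ Suc n dvd a - b"
  shows "a $ n = b $ n"
proof -
  obtain h where "a - b = fps_X ^ Suc n * h" using assms by (rule dvdE)
  then have "(a - b) $ n = 0" by (simp add: fps_X_power_mult_nth del: power_Suc)
  then show ?thesis by simp
qed

text \<open>Cancelling \<open>(qfact N)\<^sup>2\<close> against the two reciprocals is correct only
  up to q^(N-m), but the prefactor q^(c m^2) restores the missing m powers, since m \<le> c
  m^2.\<close>

lemma theta_dvd:
  assumes "c > 0"
  shows "fps_X ^ Suc N dvd (\<Sum>m\<le>N. fps_X ^ (c * m * m) * unit_bailey m)
    - (qfact N)\<^sup>2 * (\<Sum>m\<le>N. fps_X ^ (c * m * m) * unit_bailey m * iqfact (N - m) * (iqfact (N + m) :: 'a::field fps))"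
proof -
  have "fps_X ^ Suc N dvd fps_X ^ (c * m * m) * unit_bailey m
     - (qfact N)\<^sup>2 * (fps_X ^ (c * m * m) * unit_bailey m * iqfact (N - m) * (iqfact (N + m) :: 'a fps))"
    if "m \<le> N" for m
  proof -
    define u v :: "'a fps" where "u = qfact N * iqfact (N - m)" and "v = qfact N * iqfact (N + m)"
    have "fps_X ^ Suc (N - m) dvd u - 1" "fps_X ^ Suc (N - m) dvd v - 1"
      unfolding u_def v_def by (rule qfact_iqfact_dvd; simp)+
    \<comment> \<open>This combination is u v - 1, the error of the cancellation.\<close>
    then have "fps_X ^ Suc (N - m) dvd (u - 1) * v + (v - 1)"
      by (intro dvd_add dvd_mult2)
    moreover have "m \<le> c * m * m" using assms mult_le_mono[of 1 "c * m" m m] by (cases "m = 0") (simp_all add: ac_simps)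
    ultimately have "fps_X ^ m * fps_X ^ Suc (N - m) dvd fps_X ^ (c * m * m) * (((u - 1) * v + (v - 1)) * - unit_bailey m)"
      by (intro mult_dvd_mono le_imp_power_dvd dvd_mult2)
    moreover have "fps_X ^ (c * m * m) * (((u - 1) * v + (v - 1)) * - unit_bailey m) = fps_X ^ (c * m * m) * unit_bailey m
     - (qfact N)\<^sup>2 * (fps_X ^ (c * m * m) * unit_bailey m * iqfact (N - m) * (iqfact (N + m) :: 'a fps))"
      unfolding u_def v_def by (simp add: algebra_simps power2_eq_square)
    moreover have "fps_X ^ m * fps_X ^ Suc (N - m) = (fps_X ^ Suc N :: 'a fps)"
      using that by (simp flip: power_add power_Suc)
    ultimately show ?thesis by (simp only:)
  qed
  then show ?thesis
    unfolding sum_distrib_left sum_subtractf[symmetric] by (intro dvd_sum) simp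
qed

lemma rogers_ramanujan_theta_dvd:
  "fps_X ^ Suc N dvd (\<Sum>m\<le>N. fps_X ^ (m * m) * unit_bailey m) * (\<Sum>m\<le>N. fps_X ^ (2 * m * m) * unit_bailey m)
     - (qfact N)\<^sup>2 * (\<Sum>s\<le>N. fps_X ^ (s * s) * iqfact s :: 'a::field fps)"
proof -
  define S1 S2 :: "'a fps" where "S1 = (\<Sum>m\<le>N. fps_X ^ (m * m) * unit_bailey m)"
    and "S2 = (\<Sum>m\<le>N. fps_X ^ (2 * m * m) * unit_bailey m)"
  define B :: "'a fps" where "B = (\<Sum>s\<le>N. fps_X ^ (s * s) * iqfact (N - s) * iqfact s)"
  have 1: "fps_X ^ Suc N dvd S1 - qfact N"
  proof -
    have "(qfact N)\<^sup>2 * iqfact N = (qfact N :: 'a fps)"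
      by (simp add: power2_eq_square mult.assoc mult.commute[of "qfact N" "iqfact N"])
    then show ?thesis
      using theta_dvd[of 1 N, OF zero_less_one, where 'a='a]
      unfolding S1_def by (simp only: mult_1 finite_pentagonal)
  qed
  have 2: "fps_X ^ Suc N dvd S2 - (qfact N)\<^sup>2 * B"
    using theta_dvd[of 2 N, where 'a='a] unfolding S2_def B_def finite_rogers_ramanujan by simp
  have 3: "fps_X ^ Suc N dvd qfact N * B - (\<Sum>s\<le>N. fps_X ^ (s * s) * iqfact s)"
    unfolding B_def sum_distrib_left sum_subtractf[symmetric]
  proof (rule dvd_sum)
    fix s assume "s \<in> {..N}"
    then have s: "s \<le> N" by simp
    \<comment> \<open>As in \<open>theta_dvd\<close>, q^(s^2) makes up for the s powers lost in
      replacing \<open>qfact N * iqfact (N - s)\<close> by 1.\<close>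
    have "fps_X ^ s * fps_X ^ Suc (N - s) dvd fps_X ^ (s * s) * ((qfact N * iqfact (N - s) - 1) * (iqfact s :: 'a fps))"
      by (intro mult_dvd_mono le_imp_power_dvd dvd_mult2 qfact_iqfact_dvd) simp_all
    moreover have "fps_X ^ s * fps_X ^ Suc (N - s) = (fps_X ^ Suc N :: 'a fps)"
      using s by (simp flip: power_add power_Suc)
    ultimately show "fps_X ^ Suc N dvd qfact N * (fps_X ^ (s * s) * iqfact (N - s) * iqfact s) - fps_X ^ (s * s) * (iqfact s :: 'a fps)"
      by (simp add: algebra_simps del: power_Suc)
  qed
  \<comment> \<open>The three congruences are chained: with Q = \<open>qfact N\<close> and R the
    last sum, S1 S2 = Q S2 = Q^3 B = Q^2 R up to q^N.\<close>
  have "fps_X ^ Suc N dvd (S1 - qfact N) * S2 + ((S2 - (qfact N)\<^sup>2 * B) * qfact N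
      + (qfact N * B - (\<Sum>s\<le>N. fps_X ^ (s * s) * iqfact s)) * (qfact N)\<^sup>2)"
    by (intro dvd_add dvd_mult2 1 2 3)
  also have "(S1 - qfact N) * S2 + ((S2 - (qfact N)\<^sup>2 * B) * qfact N
      + (qfact N * B - (\<Sum>s\<le>N. fps_X ^ (s * s) * iqfact s)) * (qfact N)\<^sup>2)
    = S1 * S2 - (qfact N)\<^sup>2 * (\<Sum>s\<le>N. fps_X ^ (s * s) * iqfact s)"
    by (simp add: algebra_simps)
  finally show ?thesis unfolding S1_def S2_def .
qed

section \<open>Exponents of the theta series and the obstruction modulo 49\<close>

lemma theta_coeff_nonzero:
  assumes "(fps_X ^ (c * m * m) * unit_bailey m :: 'a::field fps) $ i \<noteq> 0"
  shows "\<exists>t::int. 2 * int i = (2 * int c + 1) * t\<^sup>2 + t"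
proof (cases m)
  case 0
  then have "i = 0" using assms by (auto simp: unit_bailey_def split: if_splits)
  then show ?thesis by (intro exI[of _ 0]) simp
next
  case (Suc k)
  have "(fps_X ^ (c * m * m) * unit_bailey m :: 'a fps)
     = fps_const ((-1) ^ m) * (fps_X ^ (c * m * m + (m choose 2)) + fps_X ^ (c * m * m + (m choose 2) + m))"
  proof -
    have "fps_const ((-1) ^ m) = ((-1) ^ m :: 'a fps)"
      by (simp flip: fps_const_power fps_const_neg)
    moreover have "m \<noteq> 0" using Suc by simp
    ultimately show ?thesis by (simp add: unit_bailey_def power_add distrib_left distrib_right ac_simps)
  qed
  \<comment> \<open>The two exponents are ((2c+1) m^2 - m) / 2 and ((2c+1) m^2 + m) / 2, hence t =
    -m and t = m respectively.\<close>
  then have "i = c * m * m + (m choose 2) \<or> i = c * m * m + (m choose 2) + m"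
    using assms by (auto split: if_splits)
  moreover have ch: "2 * int (m choose 2) = (int m)\<^sup>2 - int m"
  proof -
    have "2 * (m choose 2) = m * (m - 1)" using Suc by (simp add: choose_two)
    then have "2 * int (m choose 2) = int (m * (m - 1))" by (metis of_nat_mult of_nat_numeral)
    then show ?thesis using Suc by (simp add: algebra_simps power2_eq_square)
  qed
  ultimately show ?thesis
  proof (elim disjE)
    assume i: "i = c * m * m + (m choose 2)"
    show ?thesis
      by (rule exI[of _ "- int m"]) (use ch in \<open>simp add: i algebra_simps power2_eq_square\<close>)
  next
    assume i: "i = c * m * m + (m choose 2) + m"
    show ?thesis
      by (rule exI[of _ "int m"]) (use ch in \<open>simp add: i algebra_simps power2_eq_square\<close>)
  qed
qed

text \<open>Five times the form is (5x)^2 + 15 y^2, and -15, congruent to -1, is not a square modulo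
  7; so 7 divides both x and y. The proof checks all pairs of residues.\<close>

lemma seven_dvd_form:
  fixes x y :: int
  assumes "7 dvd 5 * x\<^sup>2 + 3 * y\<^sup>2"
  shows "49 dvd 5 * x\<^sup>2 + 3 * y\<^sup>2"
proof -
  have "(5 * ((x mod 7) * (x mod 7)) + 3 * ((y mod 7) * (y mod 7))) mod 7 = (5 * x\<^sup>2 + 3 * y\<^sup>2) mod 7"
    unfolding power2_eq_square by (intro mod_add_cong mod_mult_cong) simp_all
  then have *: "(5 * ((x mod 7) * (x mod 7)) + 3 * ((y mod 7) * (y mod 7))) mod 7 = 0"
    using assms by simp
  have "x mod 7 \<in> {0,1,2,3,4,5,6}" "y mod 7 \<in> {0,1,2,3,4,5,6}" by auto
  with * have "x mod 7 = 0 \<and> y mod 7 = 0" by auto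
  then obtain a b where "x = 7 * a" "y = 7 * b" by (auto elim!: dvdE simp: mod_eq_0_iff_dvd)
  then have "5 * x\<^sup>2 + 3 * y\<^sup>2 = 49 * (5 * a\<^sup>2 + 3 * b\<^sup>2)" by (simp add: power2_eq_square)
  then show ?thesis by simp
qed

lemma theta_product_coeff_zero:
  assumes "r \<in> {6, 20, 27, 34, 41, 48}"
  shows "((\<Sum>m\<le>N. fps_X ^ (m * m) * unit_bailey m) * (\<Sum>m\<le>N. fps_X ^ (2 * m * m) * unit_bailey m) :: 'a::field fps)
    $ (49 * n + r) = 0"
proof (rule ccontr)
  define S1 S2 :: "'a fps" where "S1 = (\<Sum>m\<le>N. fps_X ^ (m * m) * unit_bailey m)"
    and "S2 = (\<Sum>m\<le>N. fps_X ^ (2 * m * m) * unit_bailey m)"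
  assume "\<not> ?thesis"
  then have "(\<Sum>i=0..49 * n + r. S1 $ i * S2 $ (49 * n + r - i)) \<noteq> 0"
    unfolding S1_def[symmetric] S2_def[symmetric] fps_mult_nth .
  then obtain i where i: "i \<le> 49 * n + r" and "S1 $ i \<noteq> 0" "S2 $ (49 * n + r - i) \<noteq> 0"
    by (auto elim!: sum.not_neutral_contains_not_neutral)
  then obtain k l where k: "(fps_X ^ (k * k) * unit_bailey k :: 'a fps) $ i \<noteq> 0"
    and l: "(fps_X ^ (2 * l * l) * unit_bailey l :: 'a fps) $ (49 * n + r - i) \<noteq> 0"
    unfolding S1_def S2_def fps_sum_nth by (elim sum.not_neutral_contains_not_neutral)
  obtain t where t: "2 * int i = 3 * t\<^sup>2 + t"
    using theta_coeff_nonzero[of 1 k i, where 'a='a] k by auto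
  obtain u where u: "2 * int (49 * n + r - i) = 5 * u\<^sup>2 + u"
    using theta_coeff_nonzero[OF l] by auto
  \<comment> \<open>Completing squares: 60 (3t^2 + t) + 5 = 5 (6t + 1)^2 and 60 (5u^2 + u) + 3 = 3
    (10u + 1)^2, which explains 120 and 8 = 5 + 3.\<close>
  have "120 * (49 * int n + int r) + 8 = 60 * (2 * int i) + 60 * (2 * int (49 * n + r - i)) + 8"
    using i by simp
  also have "\<dots> = 5 * (6 * t + 1)\<^sup>2 + 3 * (10 * u + 1)\<^sup>2"
    unfolding t u by (simp add: power2_eq_square algebra_simps)
  finally have "5 * (6 * t + 1)\<^sup>2 + 3 * (10 * u + 1)\<^sup>2 = 120 * (49 * int n + int r) + 8" ..
  also have "\<dots> = 49 * (120 * int n) + (120 * int r + 8)" by simp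
  finally have eq: "5 * (6 * t + 1)\<^sup>2 + 3 * (10 * u + 1)\<^sup>2 = 49 * (120 * int n) + (120 * int r + 8)" .
  \<comment> \<open>Modulo 7 this is r + 1, and every listed r is 6 modulo 7. The class 13, absent
    from the list, is the one with 120 r + 8 divisible by 49.\<close>
  have "7 dvd 120 * int r + 8" using assms by auto
  moreover have "7 dvd 49 * (120 * int n)" by simp
  ultimately have "49 dvd 49 * (120 * int n) + (120 * int r + 8)"
    using seven_dvd_form[of "6 * t + 1" "10 * u + 1"] unfolding eq by (blast intro: dvd_add)
  then have "49 dvd 120 * int r + 8" by (simp only: dvd_add_right_iff dvd_triv_left)
  then show False using assms by auto
qed

subsection \<open>The generating function of \<open>c8\<close>\<close>

definition odds_below :: "nat \<Rightarrow> nat set" where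
  "odds_below j = {x. odd x \<and> x < 2 * j}"

lemma finite_odds_below [simp]: "finite (odds_below j)"
  by (rule finite_subset[of _ "{..<2 * j}"]) (auto simp: odds_below_def)

lemma sum_odds_below: "\<Sum>(odds_below j) = j * j"
proof (induction j)
  case (Suc j)
  have "odds_below (Suc j) = insert (2 * j + 1) (odds_below j)"
    by (auto simp: odds_below_def less_Suc_eq)
  moreover have "2 * j + 1 \<notin> odds_below j" by (simp add: odds_below_def)
  ultimately show ?case using Suc by simp
qed (simp add: odds_below_def)

text \<open>The sum j^2 recovers j. Hence the classes of partitions for different j are
  disjoint.\<close>

lemma odds_below_inject: "odds_below i = odds_below j \<longleftrightarrow> i = j"
  by (metis sum_odds_below power2_eq_square power2_eq_iff_nonneg zero_le)

text \<open>Treats (a) and (b) uniformly: for j = 0 there are no odd parts and the forbidden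
  interval is empty, which is (a). That each required odd part occurs at least once is contained in
  the first conjunct.\<close>

definition staircase_partition :: "nat \<Rightarrow> nat multiset \<Rightarrow> bool" where
  "staircase_partition j p \<longleftrightarrow>
     {x \<in> set_mset p. odd x} = odds_below j \<and>
     (\<forall>x. odd x \<longrightarrow> count p x \<le> (if x \<le> j then 2 else 1)) \<and>
     (\<forall>x. even x \<longrightarrow> count p x \<le> (if j < x \<and> x \<le> 2 * j then 0 else 1))"

lemma cond_a_iff: "cond_a p \<longleftrightarrow> staircase_partition 0 p"
proof
  assume "cond_a p"
  then show "staircase_partition 0 p"
    by (auto simp: cond_a_def staircase_partition_def odds_below_def)
next
  assume p: "staircase_partition 0 p"
  have "count p x \<le> 1" for x
  proof (cases "even x")
    case True
    then have "count p x \<le> (if 0 < x \<and> x \<le> 2 * 0 then 0 else 1)"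
      using p unfolding staircase_partition_def by blast
    then show ?thesis by (auto split: if_splits)
  next
    case False
    then have "x \<notin># p" using p by (auto simp: staircase_partition_def odds_below_def)
    then show ?thesis by (simp add: not_in_iff)
  qed
  with p show "cond_a p" by (auto simp: cond_a_def staircase_partition_def odds_below_def)
qed

lemma cond_b_iff: "cond_b j p \<longleftrightarrow> 1 \<le> j \<and> staircase_partition j p"
proof -
  have odds: "{2*i - 1 | i. 1 \<le> i \<and> i \<le> j} = odds_below j"
  proof (intro set_eqI iffI)
    fix x assume "x \<in> odds_below j"
    then show "x \<in> {2*i - 1 | i. 1 \<le> i \<and> i \<le> j}"
      by (auto simp: odds_below_def elim!: oddE intro!: exI[of _ "Suc (x div 2)"])
  qed (auto simp: odds_below_def)
  show ?thesis
  proof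
    assume b: "cond_b j p"
    then have o: "{x \<in> set_mset p. odd x} = odds_below j" unfolding cond_b_def odds by simp
    have "count p x \<le> (if x \<le> j then 2 else 1)" if "odd x" for x
      using b that by (cases "x \<in># p") (auto simp: cond_b_def not_in_iff)
    moreover have "count p x \<le> (if j < x \<and> x \<le> 2 * j then 0 else 1)" if "even x" for x
      using b that by (cases "x \<in># p") (auto simp: cond_b_def not_in_iff)
    ultimately show "1 \<le> j \<and> staircase_partition j p"
      using b o by (simp add: staircase_partition_def cond_b_def)
  next
    assume s: "1 \<le> j \<and> staircase_partition j p"
    then have o: "{x \<in> set_mset p. odd x} = odds_below j"
      and c: "\<And>x. odd x \<Longrightarrow> count p x \<le> (if x \<le> j then 2 else 1)"
      and e: "\<And>x. even x \<Longrightarrow> count p x \<le> (if j < x \<and> x \<le> 2 * j then 0 else 1)"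
      by (auto simp: staircase_partition_def)
    have "count p x = 1 \<or> count p x = 2" if "odd x" "x \<le> j" for x
    proof -
      have "x \<in> odds_below j" using that by (auto simp: odds_below_def elim: oddE)
      then have "count p x > 0" using o by auto
      moreover have "count p x \<le> 2" using c[of x] that by auto
      ultimately show ?thesis by linarith
    qed
    moreover have "count p x = 1" if "odd x" "j < x" "x \<in># p" for x
    proof -
      have "count p x > 0" using that by simp
      moreover have "count p x \<le> 1" using c[of x] that by simp
      ultimately show ?thesis by linarith
    qed
    moreover have "count p x \<le> 1" if "even x" for x
      using e[OF that] by (auto split: if_splits)
    moreover have "\<not> (j < x \<and> x \<le> 2*j)" if "even x" "x \<in># p" for x
      using e[of x] that by (auto simp flip: not_in_iff)
    ultimately show "cond_b j p" using s o unfolding cond_b_def odds by blast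
  qed
qed

text \<open>The bound \<open>N\<close> is put on i rather than on the part 2i, so that modulo 2 the
  even parts beyond 2j contribute exactly the squares of the factors of \<open>qfact N\<close>
  beyond \<open>qfact j\<close>.\<close>

definition free_parts :: "nat \<Rightarrow> nat \<Rightarrow> nat set" where
  "free_parts N j = {1..j} \<union> (\<lambda>i. 2 * i) ` {j<..N}"

lemma finite_free_parts [simp]: "finite (free_parts N j)"
  by (simp add: free_parts_def)

lemma sum_mset_mset_set: "sum_mset (mset_set A) = \<Sum>A"
  by (simp add: sum_unfold_sum_mset)

text \<open>Removing one copy of each odd part leaves a set of distinct parts, constrained only to lie in
  \<open>free_parts n j\<close>.\<close>

lemma staircase_partitions_eq_image:
  "{p \<in> partitions n. staircase_partition j p}
     = (\<lambda>D. mset_set D + mset_set (odds_below j)) ` {D. D \<subseteq> free_parts n j \<and> \<Sum>D + j * j = n}"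
  (is "?L = ?f ` ?R")
proof (intro equalityI subsetI)
  fix p assume "p \<in> ?f ` ?R"
  then obtain D where D: "D \<subseteq> free_parts n j" "\<Sum>D + j * j = n" and p: "p = ?f D" by auto
  have [simp]: "finite D" using D(1) finite_free_parts finite_subset by blast
  have sm: "sum_mset p = n" using D by (simp add: p sum_odds_below sum_mset_mset_set)
  have pos: "x > 0" if "x \<in># p" for x
    using that D(1) by (auto simp: p free_parts_def odds_below_def intro!: Nat.gr0I)
  have cnt: "count p x = (if x \<in> D then 1 else 0) + (if x \<in> odds_below j then 1 else 0)" for x
    by (simp add: p count_mset_set')
  have D_odd: "x \<le> j \<and> x \<in> odds_below j" if "x \<in> D" "odd x" for x
    using that D(1) by (auto simp: free_parts_def odds_below_def elim: oddE)
  have D_even: "\<not> (j < x \<and> x \<le> 2 * j)" if "x \<in> D" "even x" for x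
    using that D(1) by (auto simp: free_parts_def)
  show "p \<in> ?L"
  proof -
    have "{x \<in> set_mset p. odd x} = odds_below j"
      using D_odd by (auto simp: p) (auto simp: odds_below_def)
    moreover have "count p x \<le> (if x \<le> j then 2 else 1)" if "odd x" for x
      using D_odd that by (auto simp: cnt)
    moreover have "count p x \<le> (if j < x \<and> x \<le> 2 * j then 0 else 1)" if "even x" for x
      using D_even that by (auto simp: cnt) (auto simp: odds_below_def)
    ultimately show ?thesis
      using pos sm by (simp add: partitions_def staircase_partition_def)
  qed
next
  fix p assume "p \<in> ?L"
  then have pos: "\<And>x. x \<in># p \<Longrightarrow> x > 0" and sm: "sum_mset p = n"
    and o: "{x \<in> set_mset p. odd x} = odds_below j"
    and c: "\<And>x. odd x \<Longrightarrow> count p x \<le> (if x \<le> j then 2 else 1)"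
    and e: "\<And>x. even x \<Longrightarrow> count p x \<le> (if j < x \<and> x \<le> 2 * j then 0 else 1)"
    by (auto simp: partitions_def staircase_partition_def)
  \<comment> \<open>Deleting one copy of every odd part leaves the even parts and the odd parts of
    multiplicity 2.\<close>
  define D where "D = {x \<in> set_mset p. even x \<or> count p x = 2}"
  have [simp]: "finite D" by (simp add: D_def)
  have p: "p = ?f D"
  proof (rule multiset_eqI)
    fix x
    show "count p x = count (?f D) x"
    proof (cases "even x")
      case True
      have "count p x = (if x \<in># p then 1 else 0)"
      proof (cases "x \<in># p")
        case x: True
        then have "count p x > 0" by simp
        moreover have "count p x \<le> 1" using e[OF True] by (auto split: if_splits)
        ultimately have "count p x = 1" by linarith
        then show ?thesis using x by simp
      qed (simp add: not_in_iff)
      then show ?thesis using True by (simp add: D_def count_mset_set' odds_below_def)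
    next
      case False
      have "x \<in> odds_below j \<longleftrightarrow> x \<in># p" using o False by auto
      moreover have "count p x = 1 \<or> count p x = 2" if "x \<in># p"
      proof -
        have "count p x > 0" using that by simp
        moreover have "count p x \<le> 2" using c[OF False] by (auto split: if_splits)
        ultimately show ?thesis by linarith
      qed
      ultimately show ?thesis using False by (auto simp: D_def count_mset_set' not_in_iff)
    qed
  qed
  have "D \<subseteq> free_parts n j"
  proof
    fix x assume x: "x \<in> D"
    then have xp: "x \<in># p" by (simp add: D_def)
    show "x \<in> free_parts n j"
    proof (cases "x \<le> j")
      case True
      then show ?thesis using pos[OF xp] by (simp add: free_parts_def)
    next
      case False
      with x c[of x] have ev: "even x" by (cases "even x") (auto simp: D_def)
      then obtain i where i: "x = 2 * i" by blast
      have "x \<le> n" using xp sm by (auto dest!: multi_member_split)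
      moreover have "\<not> (j < x \<and> x \<le> 2 * j)" using e[OF ev] xp by (auto simp flip: not_in_iff)
      ultimately show ?thesis using False i by (auto simp: free_parts_def)
    qed
  qed
  moreover have "\<Sum>D + j * j = n"
    using sm by (subst (asm) p) (simp add: sum_odds_below sum_mset_mset_set)
  ultimately show "p \<in> ?f ` ?R" using p by blast
qed

lemma card_staircase_partitions:
  "card {p \<in> partitions n. staircase_partition j p} = card {D. D \<subseteq> free_parts n j \<and> \<Sum>D + j * j = n}"
  unfolding staircase_partitions_eq_image
proof (rule card_image, rule inj_onI)
  fix D E
  assume "D \<in> {D. D \<subseteq> free_parts n j \<and> \<Sum>D + j * j = n}" "E \<in> {D. D \<subseteq> free_parts n j \<and> \<Sum>D + j * j = n}"
    and eq: "mset_set D + mset_set (odds_below j) = mset_set E + mset_set (odds_below j)"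
  then have "finite D" "finite E" using finite_free_parts finite_subset by blast+
  then show "D = E" using eq by (simp add: mset_set_eq_iff)
qed

lemma c8_eq_sum: "c8 n = (\<Sum>j\<le>n. card {D. D \<subseteq> free_parts n j \<and> \<Sum>D + j * j = n})"
proof -
  let ?S = "\<lambda>j. {p \<in> partitions n. staircase_partition j p}"
  have fin: "finite (?S j)" for j
    unfolding staircase_partitions_eq_image
    by (rule finite_imageI, rule finite_subset[of _ "Pow (free_parts n j)"]) auto
  \<comment> \<open>The compulsory odd parts alone sum to j^2 \<ge> j, so only j \<le> n can
    occur.\<close>
  have "?S j = {}" if "j > n" for j
  proof -
    have "\<Sum>D + j * j \<noteq> n" for D
      using that by (metis le_add2 le_square le_trans not_le)
    then show ?thesis unfolding staircase_partitions_eq_image by simp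
  qed
  then have bound: "j \<le> n" if "p \<in> ?S j" for p j
    using that by (metis empty_iff not_le)
  have "{p \<in> partitions n. cond_a p \<or> (\<exists>j. cond_b j p)} = {p \<in> partitions n. \<exists>j. staircase_partition j p}"
    unfolding cond_a_iff cond_b_iff by (metis One_nat_def Suc_leI neq0_conv)
  also have "\<dots> = (\<Union>j\<in>{..n}. ?S j)"
    using bound by blast
  finally have "c8 n = card (\<Union>j\<in>{..n}. ?S j)" by (simp add: c8_def)
  also have "\<dots> = (\<Sum>j\<le>n. card (?S j))"
  proof (rule card_UN_disjoint)
    show "\<forall>i\<in>{..n}. \<forall>j\<in>{..n}. i \<noteq> j \<longrightarrow> ?S i \<inter> ?S j = {}"
      using odds_below_inject by (fastforce simp: staircase_partition_def)
  qed (use fin in auto)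
  finally show ?thesis by (simp add: card_staircase_partitions)
qed

section \<open>Product form of the counts and reduction modulo 2\<close>

lemma prod_one_plus_X_power:
  "finite A \<Longrightarrow> (\<Prod>i\<in>A. 1 + fps_X ^ i) = (\<Sum>D\<in>Pow A. fps_X ^ \<Sum>D :: 'a::comm_ring_1 fps)"
proof (induction A rule: finite_induct)
  case (insert x A)
  have "(\<Sum>D\<in>Pow (insert x A). fps_X ^ \<Sum>D :: 'a fps)
    = (\<Sum>D\<in>Pow A. fps_X ^ \<Sum>D) + (\<Sum>D\<in>insert x ` Pow A. fps_X ^ \<Sum>D)"
    unfolding Pow_insert using insert by (intro sum.union_disjoint) auto
  also have "(\<Sum>D\<in>insert x ` Pow A. fps_X ^ \<Sum>D :: 'a fps) = (\<Sum>D\<in>Pow A. fps_X ^ \<Sum>(insert x D))"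
    using insert by (intro sum.reindex_cong[of "insert x"]) (auto intro!: inj_onI)
  also have "\<dots> = (\<Sum>D\<in>Pow A. fps_X ^ x * fps_X ^ \<Sum>D)"
  proof (rule sum.cong[OF refl])
    fix D assume "D \<in> Pow A"
    then have "finite D" "x \<notin> D" using insert finite_subset by auto
    then show "fps_X ^ \<Sum>(insert x D) = fps_X ^ x * (fps_X ^ \<Sum>D :: 'a fps)" by (simp add: power_add)
  qed
  finally show ?case using insert by (simp add: distrib_right sum_distrib_left sum.distrib)
qed simp

text \<open>The truncations of the sum and of the products depend on \<open>n\<close>, so this
  concerns one coefficient at a time. Over \<open>bit\<close> the left side is the parity of
  \<open>c8 n\<close>.\<close>

lemma of_nat_c8:
  "of_nat (c8 n) = (\<Sum>j\<le>n. fps_X ^ (j * j) * (\<Prod>i\<in>free_parts n j. 1 + fps_X ^ i) :: 'a::comm_ring_1 fps) $ n"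
proof -
  have "(fps_X ^ (j * j) * (\<Prod>i\<in>free_parts n j. 1 + fps_X ^ i) :: 'a fps) $ n
     = of_nat (card {D. D \<subseteq> free_parts n j \<and> \<Sum>D + j * j = n})" for j
  proof -
    have "(fps_X ^ (j * j) * (\<Prod>i\<in>free_parts n j. 1 + fps_X ^ i) :: 'a fps)
      = (\<Sum>D\<in>Pow (free_parts n j). fps_X ^ (\<Sum>D + j * j))"
      by (simp add: prod_one_plus_X_power sum_distrib_left power_add mult.commute)
    also have "\<dots> $ n = (\<Sum>D\<in>Pow (free_parts n j). if \<Sum>D + j * j = n then 1 else 0)"
      by (auto simp: fps_sum_nth intro!: sum.cong)
    also have "\<dots> = of_nat (card {D \<in> Pow (free_parts n j). \<Sum>D + j * j = n})"
      by (simp add: sum.If_cases Int_def)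
    finally show ?thesis by simp
  qed
  then show ?thesis by (simp add: c8_eq_sum fps_sum_nth)
qed

lemma bit_fps_2: "(2 :: bit fps) = 0"
  by (simp add: numeral_fps_const)

lemma bit_fps_minus: "(a :: bit fps) - b = a + b"
  by (rule fps_ext) simp

text \<open>Modulo 2, 1 + q^i equals 1 - q^i and 1 + q^(2i) equals (1 + q^i)^2. So the product is
  (q; q)_j Q^2, where Q is the quotient of \<open>qfact N\<close> by \<open>qfact j\<close>.\<close>

lemma prod_free_parts_bit:
  assumes "j \<le> N"
  shows "(\<Prod>i\<in>free_parts N j. 1 + fps_X ^ i) = ((qfact N)\<^sup>2 * iqfact j :: bit fps)"
proof -
  have sq: "1 + fps_X ^ (2 * i) = (1 + fps_X ^ i :: bit fps)\<^sup>2" for i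
    by (simp add: power2_sum bit_fps_2 mult.commute[of 2] power_mult)
  define Q where "Q = (\<Prod>i\<in>{j<..N}. 1 + fps_X ^ i :: bit fps)"
  have qf: "qfact k = (\<Prod>i\<in>{1..k}. 1 + fps_X ^ i :: bit fps)" for k
    by (simp add: qfact_def bit_fps_minus)
  have "{1..N} = {1..j} \<union> {j<..N}" using assms by auto
  then have N: "qfact N = qfact j * Q"
    unfolding qf Q_def by (simp only:) (rule prod.union_disjoint; auto)
  have "(\<Prod>i\<in>free_parts N j. 1 + fps_X ^ i :: bit fps)
     = qfact j * (\<Prod>i\<in>(\<lambda>i. 2 * i) ` {j<..N}. 1 + fps_X ^ i)"
    unfolding free_parts_def qf by (rule prod.union_disjoint) auto
  also have "(\<Prod>i\<in>(\<lambda>i. 2 * i) ` {j<..N}. 1 + fps_X ^ i :: bit fps) = Q\<^sup>2"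
    unfolding Q_def by (subst prod.reindex) (auto simp: inj_on_def sq prod_power_distrib)
  also have "qfact j * Q\<^sup>2 = (iqfact j * qfact j) * (qfact j * Q\<^sup>2)"
    by simp
  also have "\<dots> = (qfact N)\<^sup>2 * iqfact j"
    unfolding N by (simp add: power2_eq_square ac_simps del: iqfact_mult_qfact)
  finally show ?thesis .
qed

lemma of_nat_c8_bit_eq_theta:
  "(of_nat (c8 n) :: bit) =
     ((\<Sum>m\<le>n. fps_X ^ (m * m) * unit_bailey m) * (\<Sum>m\<le>n. fps_X ^ (2 * m * m) * unit_bailey m)) $ n"
proof -
  have "(\<Sum>j\<le>n. fps_X ^ (j * j) * (\<Prod>i\<in>free_parts n j. 1 + fps_X ^ i) :: bit fps)
    = (qfact n)\<^sup>2 * (\<Sum>s\<le>n. fps_X ^ (s * s) * iqfact s)"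
    by (simp add: prod_free_parts_bit sum_distrib_left ac_simps)
  also have "\<dots> $ n =
      ((\<Sum>m\<le>n. fps_X ^ (m * m) * unit_bailey m) * (\<Sum>m\<le>n. fps_X ^ (2 * m * m) * unit_bailey m)) $ n"
    \<comment> \<open>Truncating at N = n gives a congruence modulo q^(n+1), which just reaches
      coefficient n.\<close>
    by (rule fps_nth_eq_if_X_power_dvd_diff[OF rogers_ramanujan_theta_dvd, symmetric])
  finally show ?thesis unfolding of_nat_c8 .
qed

theorem theorem9:
  fixes n r :: nat
  assumes "r \<in> {6, 20, 27, 34, 41, 48}"
  shows "c8 (49 * n + r) mod 2 = 0"
proof -
  have "(of_nat (c8 (49 * n + r)) :: bit) = 0"
    unfolding of_nat_c8_bit_eq_theta using assms by (rule theta_product_coeff_zero)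
  then have "even (of_nat (c8 (49 * n + r)) :: bit)" by (simp only: dvd_0_right)
  then show ?thesis unfolding even_of_nat_iff by (rule even_iff_mod_2_eq_zero[THEN iffD1])
qed

end
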